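(* For every $x\in\mathbb S$ and every $A\subset\mathbb S\setminus\{x\}$ such that $\sum_{y\in A}\lambda_y<\infty$, $$\lim_{t\searrow 0}\frac{\mathbb P(X^x(t)\in A)}{t}=0.$$ In particular (taking $A=\{y\}$), for every $y\in\mathbb S\setminus\{x\}$ the transition rate $q_{xy}$ exists and $q_{xy}=0$.
   Context: Let $\mathbb S$ be a countably infinite set, $\infty$ a symbol not in $\mathbb S$, and $\bar{\mathbb S}=\mathbb S\cup\{\infty\}$. The parameters are strictly positive reals $\{\gamma_x,\lambda_x:x\in\mathbb S\}$ and a constant $c\ge 0$, with $\sum_{x\in\mathbb S}\lambda_x=\infty$ and $\sum_{x\in\mathbb S}\lambda_x\gamma_x<\infty$; set $\gamma_\infty=0$. On a probability space $(\Omega,\mathcal F,\mathbb P)$ let the following be independent: a family $\{N_x:x\in\mathbb S\}$ of independent Poisson processes on $\mathbb R^+$, $N_x$ of rate $\lambda_x$ with marks $0<\sigma^x_1<\sigma^x_2<\cdots$ ($N_x(t)$ is the number of marks in $[0,t]$), and a family $\{T_0\}\cup\{T^x_n:n\ge 1,x\in\mathbb S\}$ of i.i.d. exponential random variables of rate $1$. Clock process: for $y\in\bar{\mathbb S}$, $t\ge 0$, $\Gamma^y(t)=\gamma_yT_0+\sum_{z\in\mathbb S}\sum_{i=1}^{N_z(t)}\gamma_zT^z_i+ct$ (empty sums are $0$), and $\Gamma^y(s-)$ denotes its left limit at $s$. K process with initial state $y\in\bar{\mathbb S}$: $X^y(t)=y$ if $t<\gamma_yT_0$; $X^y(t)=x$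 (with $x\in\mathbb S$) if $t\in\bigcup_{i\ge 1}[\Gamma^y(\sigma^x_i-),\Gamma^y(\sigma^x_i))$; $X^y(t)=\infty$ otherwise. Transition functions and rates: $p_{xy}(t)=\mathbb P(X^x(t)=y)$ and $q_{xy}=\lim_{t\searrow 0}\frac{p_{xy}(t)-\mathbb I\{x=y\}}{t}$ for $x,y\in\bar{\mathbb S}$, where $\mathbb I$ denotes the indicator. *)

theory Defs
  imports "HOL-Probability.Probability"
begin

text \<open>
  The state space is \<open>'a option\<close>, where \<open>'a\<close> is the countably infinite set of ordinary states and
  \<open>None\<close> is the extra state at infinity. As in the usual notation, the marks \<open>\<sigma> x i\<close> and
  the exponential variables \<open>T x i\<close> are indexed by \<open>i \<ge> 1\<close>; the values at \<open>i = 0\<close> are never used.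
\<close>

definition marks_count :: "(nat \<Rightarrow> 'w \<Rightarrow> real) \<Rightarrow> real \<Rightarrow> 'w \<Rightarrow> nat" where
  "marks_count s t \<omega> = card {i. 1 \<le> i \<and> s i \<omega> \<le> t}"

text \<open>
  The marks form a locally finite sequence; without the finiteness requirement \<open>card\<close> in
  \<open>marks_count\<close> would return 0 for an infinite set of marks.
\<close>

definition marks_on :: "'w set \<Rightarrow> (nat \<Rightarrow> 'w \<Rightarrow> real) \<Rightarrow> bool" where
  "marks_on \<Omega> s \<longleftrightarrow> (\<forall>\<omega>\<in>\<Omega>. 0 < s 1 \<omega> \<and> (\<forall>i\<ge>1. s i \<omega> < s (Suc i) \<omega>) \<and>
     (\<forall>t. finite {i. 1 \<le> i \<and> s i \<omega> \<le> t}))"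

text \<open>
  The subtraction of natural numbers below is harmless, because the law of the process is only
  imposed on counting processes, whose paths are nondecreasing.
\<close>

definition poisson_process :: "'w measure \<Rightarrow> real \<Rightarrow> (real \<Rightarrow> 'w \<Rightarrow> nat) \<Rightarrow> bool" where
  "poisson_process M r N \<longleftrightarrow>
     (\<forall>t\<ge>0. N t \<in> measurable M (count_space UNIV)) \<and>
     (AE \<omega> in M. N 0 \<omega> = 0) \<and>
     (\<forall>\<omega>\<in>space M. mono_on {0..} (\<lambda>t. N t \<omega>)) \<and>
     (\<forall>s t. 0 \<le> s \<longrightarrow> s < t \<longrightarrow>
        distr M (count_space UNIV) (\<lambda>\<omega>. N t \<omega> - N s \<omega>) = measure_pmf (poisson_pmf (r * (t - s)))) \<and>
     (\<forall>(u :: nat \<Rightarrow> real) n. 0 \<le> u 0 \<longrightarrow> mono u \<longrightarrow>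
        prob_space.indep_vars M (\<lambda>_. count_space UNIV) (\<lambda>k \<omega>. N (u (Suc k)) \<omega> - N (u k) \<omega>) {..<n})"

text \<open>The family \<open>{T0} \<union> {T x n | n \<ge> 1}\<close> as one indexed family; \<open>None\<close> is the index of \<open>T0\<close>.\<close>

definition holding_index :: "('a \<times> nat) option set" where
  "holding_index = insert None (Some ` (UNIV \<times> {1..}))"

definition holding_family ::
  "('w \<Rightarrow> real) \<Rightarrow> ('a \<Rightarrow> nat \<Rightarrow> 'w \<Rightarrow> real) \<Rightarrow> ('a \<times> nat) option \<Rightarrow> 'w \<Rightarrow> real" where
  "holding_family T0 T k = (case k of None \<Rightarrow> T0 | Some (x, n) \<Rightarrow> T x n)"

definition gamma_bar :: "('a \<Rightarrow> real) \<Rightarrow> 'a option \<Rightarrow> real" where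
  "gamma_bar \<gamma> y = (case y of None \<Rightarrow> 0 | Some x \<Rightarrow> \<gamma> x)"

text \<open>
  The clock takes values in \<open>[0, \<infinity>]\<close>, so that the infinite sum and the left limits exist on the whole
  probability space and not just almost surely; exponential variables are nonnegative almost
  surely, so that \<open>ennreal\<close> truncates only on a null set.
\<close>

definition clock :: "('a \<Rightarrow> real) \<Rightarrow> real \<Rightarrow> ('a \<Rightarrow> nat \<Rightarrow> 'w \<Rightarrow> real) \<Rightarrow> ('w \<Rightarrow> real) \<Rightarrow>
    ('a \<Rightarrow> nat \<Rightarrow> 'w \<Rightarrow> real) \<Rightarrow> 'a option \<Rightarrow> real \<Rightarrow> 'w \<Rightarrow> ennreal" where
  "clock \<gamma> c \<sigma> T0 T y t \<omega> =
     ennreal (gamma_bar \<gamma> y * T0 \<omega>)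
     + (\<Sum>\<^sub>\<infinity>z. \<Sum>i = 1..marks_count (\<sigma> z) t \<omega>. ennreal (\<gamma> z * T z i \<omega>))
     + ennreal (c * t)"

definition clock_left :: "('a \<Rightarrow> real) \<Rightarrow> real \<Rightarrow> ('a \<Rightarrow> nat \<Rightarrow> 'w \<Rightarrow> real) \<Rightarrow> ('w \<Rightarrow> real) \<Rightarrow>
    ('a \<Rightarrow> nat \<Rightarrow> 'w \<Rightarrow> real) \<Rightarrow> 'a option \<Rightarrow> real \<Rightarrow> 'w \<Rightarrow> ennreal" where
  "clock_left \<gamma> c \<sigma> T0 T y s \<omega> = Lim (at_left s) (\<lambda>r. clock \<gamma> c \<sigma> T0 T y r \<omega>)"

definition visits :: "('a \<Rightarrow> real) \<Rightarrow> real \<Rightarrow> ('a \<Rightarrow> nat \<Rightarrow> 'w \<Rightarrow> real) \<Rightarrow> ('w \<Rightarrow> real) \<Rightarrow>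
    ('a \<Rightarrow> nat \<Rightarrow> 'w \<Rightarrow> real) \<Rightarrow> 'a option \<Rightarrow> real \<Rightarrow> 'w \<Rightarrow> 'a \<Rightarrow> bool" where
  "visits \<gamma> c \<sigma> T0 T y t \<omega> x \<longleftrightarrow>
     ennreal t \<in> (\<Union>i\<in>{1..}. {clock_left \<gamma> c \<sigma> T0 T y (\<sigma> x i \<omega>) \<omega> ..< clock \<gamma> c \<sigma> T0 T y (\<sigma> x i \<omega>) \<omega>})"

text \<open>
  The state \<open>x\<close> in the middle case is unique except on the null event that two of the Poisson
  processes have a common mark.
\<close>

definition K_process :: "('a \<Rightarrow> real) \<Rightarrow> real \<Rightarrow> ('a \<Rightarrow> nat \<Rightarrow> 'w \<Rightarrow> real) \<Rightarrow> ('w \<Rightarrow> real) \<Rightarrow>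
    ('a \<Rightarrow> nat \<Rightarrow> 'w \<Rightarrow> real) \<Rightarrow> 'a option \<Rightarrow> real \<Rightarrow> 'w \<Rightarrow> 'a option" where
  "K_process \<gamma> c \<sigma> T0 T y t \<omega> =
     (if t < gamma_bar \<gamma> y * T0 \<omega> then y
      else if \<exists>x. visits \<gamma> c \<sigma> T0 T y t \<omega> x then Some (THE x. visits \<gamma> c \<sigma> T0 T y t \<omega> x)
      else None)"

definition transition_prob :: "'w measure \<Rightarrow> ('s \<Rightarrow> real \<Rightarrow> 'w \<Rightarrow> 's) \<Rightarrow> 's \<Rightarrow> 's \<Rightarrow> real \<Rightarrow> real" where
  "transition_prob M X x y t = measure M {\<omega> \<in> space M. X x t \<omega> = y}"

text \<open>The transition rate from \<open>x\<close> to \<open>y\<close> exists and equals \<open>q\<close>.\<close>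

definition has_transition_rate ::
  "'w measure \<Rightarrow> ('s \<Rightarrow> real \<Rightarrow> 'w \<Rightarrow> 's) \<Rightarrow> 's \<Rightarrow> 's \<Rightarrow> real \<Rightarrow> bool" where
  "has_transition_rate M X x y q \<longleftrightarrow>
     ((\<lambda>t. (transition_prob M X x y t - of_bool (x = y)) / t) \<longlongrightarrow> q) (at_right 0)"

end

theory Submission
  imports Defs
begin

text \<open>
  To be in \<open>A\<close> at time \<open>t\<close>, the process started at \<open>x\<close>
  first has to leave \<open>x\<close>, which means \<open>\<gamma> x * T0 \<le> t\<close> and
  already has probability of order \<open>t\<close>. It remains to see that, independently of
  this, the process is unlikely to be in \<open>A\<close> immediately afterwards. Since the rates
  in \<open>A\<close> have a finite sum, with high probability no mark of a state of
  \<open>A\<close> occurs before a given small \<open>\<epsilon> > 0\<close>. Since the rates of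
  all states have an infinite sum, some other state has a mark before \<open>\<epsilon>\<close>,
  and the clock has then grown by a strictly positive amount, which exceeds \<open>t\<close> when
  \<open>t\<close> is small. So the first visit to \<open>A\<close> comes too late.

  The argument is made quantitative with a finite set \<open>F\<close> of states in place of all states. The path
  inequality \<open>K_process_in_imp\<close> and the independence of \<open>T0\<close> from the marks and from the other holding
  times give in \<open>K_process_prob_le\<close>, for all \<open>\<epsilon> > 0\<close> and finite \<open>F\<close>, the bound
  \<open>t / \<gamma> x * (\<epsilon> * infsum lam A + exp (- (\<epsilon> * sum lam F)) + (\<Sum>z\<in>F. t / \<gamma> z))\<close>
  for the probability of being in \<open>A\<close> at time \<open>t\<close>. After division by \<open>t\<close> it is made small by the
  choice of \<open>\<epsilon>\<close>, \<open>F\<close> and \<open>t\<close>, in this order. The path inequality needs that no two states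
  have a common mark, which holds almost surely by \<open>no_common_marks\<close>.
\<close>

section \<open>Marks and the clock along a path\<close>

lemma marks_on_strict_mono:
  assumes m: "marks_on \<Omega> s" and w: "\<omega> \<in> \<Omega>" and i: "1 \<le> i" and ij: "i < j"
  shows "s i \<omega> < s j \<omega>"
proof -
  have "Suc i \<le> j" using ij by simp
  then show ?thesis
  proof (induction j rule: dec_induct)
    case base
    show ?case using m w i unfolding marks_on_def by blast
  next
    case (step n)
    have "s n \<omega> < s (Suc n) \<omega>"
      using m w i step.hyps(1) unfolding marks_on_def by auto
    then show ?case using step.IH by linarith
  qed
qed

lemma marks_count_mono:
  assumes m: "marks_on \<Omega> s" and w: "\<omega> \<in> \<Omega>" and "u \<le> v"
  shows "marks_count s u \<omega> \<le> marks_count s v \<omega>"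
  unfolding marks_count_def
  using m w \<open>u \<le> v\<close> by (intro card_mono) (auto simp: marks_on_def)

lemma marks_count_less:
  assumes m: "marks_on \<Omega> s" and w: "\<omega> \<in> \<Omega>" and i: "1 \<le> i" "u < s i \<omega>" "s i \<omega> \<le> v"
  shows "marks_count s u \<omega> < marks_count s v \<omega>"
  unfolding marks_count_def
proof (rule psubset_card_mono)
  show "finite {i. 1 \<le> i \<and> s i \<omega> \<le> v}"
    using m w by (simp add: marks_on_def)
  have "i \<notin> {i. 1 \<le> i \<and> s i \<omega> \<le> u}" "i \<in> {i. 1 \<le> i \<and> s i \<omega> \<le> v}"
    using i by auto
  moreover have "{i. 1 \<le> i \<and> s i \<omega> \<le> u} \<subseteq> {i. 1 \<le> i \<and> s i \<omega> \<le> v}"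
    using i by auto
  ultimately show "{i. 1 \<le> i \<and> s i \<omega> \<le> u} \<subset> {i. 1 \<le> i \<and> s i \<omega> \<le> v}"
    by blast
qed

lemma marks_count_eq_0_iff:
  assumes m: "marks_on \<Omega> s" and w: "\<omega> \<in> \<Omega>"
  shows "marks_count s t \<omega> = 0 \<longleftrightarrow> t < s 1 \<omega>"
proof -
  have fin: "finite {i. 1 \<le> i \<and> s i \<omega> \<le> t}"
    using m w by (simp add: marks_on_def)
  have le: "s 1 \<omega> \<le> s i \<omega>" if "1 \<le> i" for i
    using marks_on_strict_mono[OF m w, of 1 i] that by (cases "i = 1") auto
  have "marks_count s t \<omega> = 0 \<longleftrightarrow> {i. 1 \<le> i \<and> s i \<omega> \<le> t} = {}"
    unfolding marks_count_def using fin by simp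
  also have "\<dots> \<longleftrightarrow> t < s 1 \<omega>"
    using le by (auto simp: not_le[symmetric] intro: order_trans)
  finally show ?thesis .
qed

lemma marks_count_0:
  assumes m: "marks_on \<Omega> s" and w: "\<omega> \<in> \<Omega>"
  shows "marks_count s 0 \<omega> = 0"
  using marks_count_eq_0_iff[OF m w, of 0] m w by (simp add: marks_on_def)

lemma clock_mono:
  assumes m: "\<And>x. marks_on \<Omega> (\<sigma> x)" and w: "\<omega> \<in> \<Omega>" and c: "0 \<le> c" and "u \<le> v"
  shows "clock \<gamma> c \<sigma> T0 T y u \<omega> \<le> clock \<gamma> c \<sigma> T0 T y v \<omega>"
proof -
  have "(\<Sum>\<^sub>\<infinity>z. \<Sum>i = 1..marks_count (\<sigma> z) u \<omega>. ennreal (\<gamma> z * T z i \<omega>))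
      \<le> (\<Sum>\<^sub>\<infinity>z. \<Sum>i = 1..marks_count (\<sigma> z) v \<omega>. ennreal (\<gamma> z * T z i \<omega>))"
    by (intro infsum_mono nonneg_summable_on_complete sum_mono2)
       (auto intro: order_trans[OF _ marks_count_mono[OF m w \<open>u \<le> v\<close>]])
  moreover have "ennreal (c * u) \<le> ennreal (c * v)"
    using c \<open>u \<le> v\<close> by (intro ennreal_leI mult_left_mono)
  ultimately show ?thesis
    unfolding clock_def by (intro add_mono) auto
qed

text \<open>
  \<open>Lim\<close> carries information only where the limit exists. The clock is monotone with values in a
  complete linear order, so its left limit exists everywhere and is a supremum.
\<close>

lemma clock_left_eq_SUP:
  assumes m: "\<And>x. marks_on \<Omega> (\<sigma> x)" and w: "\<omega> \<in> \<Omega>" and c: "0 \<le> c"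
  shows "clock_left \<gamma> c \<sigma> T0 T y s \<omega> = (SUP r\<in>{..<s}. clock \<gamma> c \<sigma> T0 T y r \<omega>)"
proof -
  let ?C = "\<lambda>r. clock \<gamma> c \<sigma> T0 T y r \<omega>"
  have "(?C \<longlongrightarrow> (SUP r\<in>{..<s}. ?C r)) (at_left s)"
  proof (rule increasing_tendsto)
    show "eventually (\<lambda>r. ?C r \<le> (SUP r\<in>{..<s}. ?C r)) (at_left s)"
      by (auto simp: eventually_at_filter intro!: SUP_upper always_eventually)
  next
    fix x assume "x < (SUP r\<in>{..<s}. ?C r)"
    then obtain r where r: "r < s" "x < ?C r" by (auto simp: less_SUP_iff)
    show "eventually (\<lambda>r. x < ?C r) (at_left s)"
      using eventually_at_left_real[OF r(1)]
    proof eventually_elim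
      case (elim q)
      have "?C r \<le> ?C q" using elim by (intro clock_mono[OF m w c]) auto
      then show ?case using r(2) by simp
    qed
  qed
  then show ?thesis
    unfolding clock_left_def by (intro tendsto_Lim) auto
qed

lemma clock_le_clock_left:
  assumes m: "\<And>x. marks_on \<Omega> (\<sigma> x)" and w: "\<omega> \<in> \<Omega>" and c: "0 \<le> c" and "r < s"
  shows "clock \<gamma> c \<sigma> T0 T y r \<omega> \<le> clock_left \<gamma> c \<sigma> T0 T y s \<omega>"
  unfolding clock_left_eq_SUP[where \<Omega> = \<Omega> and \<sigma> = \<sigma>, OF m w c] using \<open>r < s\<close> by (intro SUP_upper) auto

lemma holding_le_clock:
  assumes "1 \<le> marks_count (\<sigma> z) t \<omega>"
  shows "ennreal (\<gamma> z * T z 1 \<omega>) \<le> clock \<gamma> c \<sigma> T0 T y t \<omega>"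
proof -
  let ?f = "\<lambda>z. \<Sum>i = 1..marks_count (\<sigma> z) t \<omega>. ennreal (\<gamma> z * T z i \<omega>)"
  have "ennreal (\<gamma> z * T z 1 \<omega>) = (\<Sum>i\<in>{1}. ennreal (\<gamma> z * T z i \<omega>))" by simp
  also have "\<dots> \<le> ?f z" using assms by (intro sum_mono2) auto
  also have "\<dots> = infsum ?f {z}" by simp
  also have "\<dots> \<le> infsum ?f UNIV"
    by (intro infsum_mono_neutral nonneg_summable_on_complete) auto
  also have "\<dots> \<le> clock \<gamma> c \<sigma> T0 T y t \<omega>"
    unfolding clock_def by (intro add_increasing2 add_increasing) auto
  finally show ?thesis .
qed

text \<open>
  By \<open>clock_le_clock_left\<close> the clock intervals that belong to two different marks do not overlap,
  so two states can claim the same time only through a common mark.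
\<close>

lemma visits_unique:
  assumes m: "\<And>x. marks_on \<Omega> (\<sigma> x)" and w: "\<omega> \<in> \<Omega>" and c: "0 \<le> c"
    and disj: "\<And>i j. 1 \<le> i \<Longrightarrow> 1 \<le> j \<Longrightarrow> x \<noteq> x' \<Longrightarrow> \<sigma> x i \<omega> \<noteq> \<sigma> x' j \<omega>"
    and v: "visits \<gamma> c \<sigma> T0 T y t \<omega> x" and v': "visits \<gamma> c \<sigma> T0 T y t \<omega> x'"
  shows "x = x'"
proof (rule ccontr)
  assume ne: "x \<noteq> x'"
  let ?C = "\<lambda>r. clock \<gamma> c \<sigma> T0 T y r \<omega>" and ?L = "\<lambda>r. clock_left \<gamma> c \<sigma> T0 T y r \<omega>"
  obtain i where i: "1 \<le> i" "?L (\<sigma> x i \<omega>) \<le> ennreal t" "ennreal t < ?C (\<sigma> x i \<omega>)"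
    using v unfolding visits_def by auto
  obtain j where j: "1 \<le> j" "?L (\<sigma> x' j \<omega>) \<le> ennreal t" "ennreal t < ?C (\<sigma> x' j \<omega>)"
    using v' unfolding visits_def by auto
  have "?C (\<sigma> x i \<omega>) \<le> ?L (\<sigma> x' j \<omega>)" if "\<sigma> x i \<omega> < \<sigma> x' j \<omega>"
    using clock_le_clock_left[where \<sigma> = \<sigma>, OF m w c that] .
  moreover have "?C (\<sigma> x' j \<omega>) \<le> ?L (\<sigma> x i \<omega>)" if "\<sigma> x' j \<omega> < \<sigma> x i \<omega>"
    using clock_le_clock_left[where \<sigma> = \<sigma>, OF m w c that] .
  ultimately show False
    using disj[OF i(1) j(1) ne] i j by (metis leD linorder_neqE order.trans)
qed

text \<open>
  The path inequality behind the theorem. If the process is in \<open>A\<close> at time \<open>t\<close>, it has left \<open>x\<close>, and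
  the clock just before some mark of a state of \<open>A\<close> is at most \<open>t\<close>. If the marks of \<open>A\<close> all come
  after \<open>\<epsilon>\<close>, then the clock at \<open>\<epsilon>\<close> is at most \<open>t\<close> as well; if moreover some \<open>z \<in> F\<close> has a mark by
  then, its first holding time has already been added to the clock. The set \<open>F\<close> keeps all this
  within finitely many variables.
\<close>

lemma K_process_in_imp:
  assumes m: "\<And>x. marks_on \<Omega> (\<sigma> x)" and w: "\<omega> \<in> \<Omega>" and c: "0 \<le> c" and t: "0 \<le> t"
    and disj: "\<And>a b i j. a \<noteq> b \<Longrightarrow> 1 \<le> i \<Longrightarrow> 1 \<le> j \<Longrightarrow> \<sigma> a i \<omega> \<noteq> \<sigma> b j \<omega>"
    and x: "x \<notin> A" and K: "K_process \<gamma> c \<sigma> T0 T (Some x) t \<omega> \<in> Some ` A"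
  shows "\<gamma> x * T0 \<omega> \<le> t"
    and "(\<exists>a\<in>A. marks_count (\<sigma> a) \<epsilon> \<omega> \<noteq> 0) \<or> (\<forall>z\<in>F. marks_count (\<sigma> z) \<epsilon> \<omega> = 0) \<or>
      (\<exists>z\<in>F. \<gamma> z * T z 1 \<omega> \<le> t)"
proof -
  show *: "\<gamma> x * T0 \<omega> \<le> t"
    using K x by (auto simp: K_process_def gamma_bar_def not_le split: if_splits)
  have nt: "\<not> t < gamma_bar \<gamma> (Some x) * T0 \<omega>"
    using * by (simp add: gamma_bar_def)
  then obtain b where b: "visits \<gamma> c \<sigma> T0 T (Some x) t \<omega> b"
    using K by (auto simp: K_process_def split: if_splits)
  then have K': "K_process \<gamma> c \<sigma> T0 T (Some x) t \<omega>
        = Some (THE z. visits \<gamma> c \<sigma> T0 T (Some x) t \<omega> z)"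
    using nt by (auto simp: K_process_def)
  have "(THE z. visits \<gamma> c \<sigma> T0 T (Some x) t \<omega> z) = b"
    using b by (rule the_equality) (use visits_unique[where \<sigma> = \<sigma>, OF m w c] disj b in metis)
  then have "b \<in> A" using K K' by auto
  obtain i where i: "1 \<le> i" "clock_left \<gamma> c \<sigma> T0 T (Some x) (\<sigma> b i \<omega>) \<omega> \<le> ennreal t"
    using b unfolding visits_def by auto
  show "(\<exists>a\<in>A. marks_count (\<sigma> a) \<epsilon> \<omega> \<noteq> 0) \<or> (\<forall>z\<in>F. marks_count (\<sigma> z) \<epsilon> \<omega> = 0) \<or>
      (\<exists>z\<in>F. \<gamma> z * T z 1 \<omega> \<le> t)"
  proof (cases "marks_count (\<sigma> b) \<epsilon> \<omega> = 0 \<and> (\<exists>z\<in>F. marks_count (\<sigma> z) \<epsilon> \<omega> \<noteq> 0)")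
    case True
    then obtain z where z: "z \<in> F" "marks_count (\<sigma> z) \<epsilon> \<omega> \<noteq> 0" by blast
    have "\<epsilon> < \<sigma> b 1 \<omega>" using True marks_count_eq_0_iff[OF m w] by metis
    also have "\<sigma> b 1 \<omega> \<le> \<sigma> b i \<omega>"
      using marks_on_strict_mono[OF m w, of 1 i b] i(1) by (cases "i = 1") auto
    finally have "\<epsilon> < \<sigma> b i \<omega>" .
    have "ennreal (\<gamma> z * T z 1 \<omega>) \<le> clock \<gamma> c \<sigma> T0 T (Some x) \<epsilon> \<omega>"
      using z(2) by (intro holding_le_clock) auto
    also have "\<dots> \<le> clock_left \<gamma> c \<sigma> T0 T (Some x) (\<sigma> b i \<omega>) \<omega>"
      using clock_le_clock_left[where \<sigma> = \<sigma>, OF m w c \<open>\<epsilon> < \<sigma> b i \<omega>\<close>] .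
    also have "\<dots> \<le> ennreal t" by fact
    finally have "\<gamma> z * T z 1 \<omega> \<le> t" using t by (simp add: ennreal_le_iff)
    then show ?thesis using z(1) by blast
  qed (use \<open>b \<in> A\<close> in blast)
qed

section \<open>Independent Poisson processes\<close>

lemma (in prob_space) prob_UN_le_infsum:
  fixes E :: "'i::countable \<Rightarrow> 'a set"
  assumes E: "\<And>i. i \<in> I \<Longrightarrow> E i \<in> events" and le: "\<And>i. i \<in> I \<Longrightarrow> prob (E i) \<le> p i"
    and p: "p summable_on I"
  shows "prob (\<Union>i\<in>I. E i) \<le> infsum p I"
proof (rule measure_UN_bound)
  show "countable I" by simp
  show "E i \<in> fmeasurable M" if "i \<in> I" for i
    using E[OF that] by (simp add: fmeasurable_eq_sets)
  fix J assume J: "J \<subseteq> I" "finite J"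
  have "prob (\<Union>i\<in>J. E i) \<le> (\<Sum>i\<in>J. prob (E i))"
    using J E by (intro measure_UNION_le) auto
  also have "\<dots> \<le> sum p J"
    using J le by (intro sum_mono) auto
  also have "\<dots> \<le> infsum p I"
    using J p by (intro finite_sum_le_infsum) (auto intro: order_trans[OF measure_nonneg le])
  finally show "prob (\<Union>i\<in>J. E i) \<le> infsum p I" .
qed

lemma (in prob_space) poisson_no_increment_prob:
  assumes N: "poisson_process M r N" and r: "0 < r" and st: "0 \<le> s" "s < t"
  shows "prob {\<omega> \<in> space M. N t \<omega> - N s \<omega> = 0} = exp (- (r * (t - s)))"
proof -
  let ?D = "\<lambda>\<omega>. N t \<omega> - N s \<omega>"
  have meas: "?D \<in> measurable M (count_space UNIV)"
  proof -
    have [measurable]: "N s \<in> measurable M (count_space UNIV)" "N t \<in> measurable M (count_space UNIV)"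
      using N st unfolding poisson_process_def by auto
    show ?thesis by measurable
  qed
  have "prob {\<omega> \<in> space M. ?D \<omega> = 0} = measure (distr M (count_space UNIV) ?D) {0}"
    using meas by (subst measure_distr) (auto intro!: arg_cong[where f = prob])
  also have "\<dots> = measure (measure_pmf (poisson_pmf (r * (t - s)))) {0}"
    using N st unfolding poisson_process_def by auto
  also have "\<dots> = exp (- (r * (t - s)))"
    using r st by (simp add: measure_pmf_single)
  finally show ?thesis .
qed

lemma (in prob_space) poisson_increment_prob_le:
  assumes N: "poisson_process M r N" and r: "0 < r" and st: "0 \<le> s" "s < t"
  shows "prob {\<omega> \<in> space M. N t \<omega> - N s \<omega> \<noteq> 0} \<le> r * (t - s)"
proof -
  have [measurable]: "N s \<in> measurable M (count_space UNIV)" "N t \<in> measurable M (count_space UNIV)"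
    using N st unfolding poisson_process_def by auto
  have "prob {\<omega> \<in> space M. N t \<omega> - N s \<omega> \<noteq> 0} = 1 - prob {\<omega> \<in> space M. N t \<omega> - N s \<omega> = 0}"
    by (intro prob_neg) measurable
  also have "\<dots> = 1 - exp (- (r * (t - s)))"
    using poisson_no_increment_prob[OF N r st] by simp
  also have "\<dots> \<le> r * (t - s)"
    using exp_ge_add_one_self[of "- (r * (t - s))"] by linarith
  finally show ?thesis .
qed

lemma (in prob_space) increments_indep:
  assumes indep: "indep_vars (\<lambda>_. \<Pi>\<^sub>M t\<in>{0..}. count_space UNIV) (\<lambda>x \<omega>. \<lambda>t\<in>{0..}. N x t \<omega>) UNIV"
    and st: "0 \<le> s" "0 \<le> (t::real)"
  shows "indep_vars (\<lambda>_. count_space UNIV) (\<lambda>x \<omega>. N x t \<omega> - N x s \<omega> :: nat) UNIV"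
proof -
  have "indep_vars (\<lambda>_. count_space UNIV)
      (\<lambda>x \<omega>. (\<lambda>f. f t - f s :: nat) (\<lambda>t\<in>{0..}. N x t \<omega>)) UNIV"
  proof (rule indep_vars_compose2[OF indep])
    have comp: "(\<lambda>f. f u) \<in> measurable (\<Pi>\<^sub>M t\<in>{0..}. count_space UNIV) (count_space (UNIV :: nat set))"
      if "0 \<le> u" for u :: real
      using that by (intro measurable_component_singleton) auto
    have diff: "(\<lambda>f. g f - h f) \<in> measurable P (count_space UNIV)"
      if [measurable]: "g \<in> measurable P (count_space UNIV)" "h \<in> measurable P (count_space UNIV)"
      for g h :: "_ \<Rightarrow> nat" and P
      by measurable
    show "(\<lambda>f. f t - f s) \<in> measurable (\<Pi>\<^sub>M t\<in>{0..}. count_space UNIV) (count_space (UNIV :: nat set))"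
      by (rule diff; rule comp; fact st)
  qed
  then show ?thesis using st by simp
qed

text \<open>
  A common mark in \<open>(0, n]\<close> makes both processes jump in one of the \<open>n m\<close> cells of length \<open>1 / m\<close>.
  Each cell has probability at most \<open>lam a * lam b / m\<^sup>2\<close> of this, so the total is of order \<open>1 / m\<close>.
  This is what makes the definite description in \<open>K_process\<close> meaningful almost surely: at a common
  mark it could denote any state, even one in the target set.
\<close>

lemma (in prob_space) no_common_marks:
  fixes \<sigma> :: "'i \<Rightarrow> nat \<Rightarrow> 'a \<Rightarrow> real"
  assumes marks: "\<And>x. marks_on (space M) (\<sigma> x)"
    and poisson: "\<And>x. poisson_process M (lam x) (marks_count (\<sigma> x))"
    and lam: "\<And>x. 0 < lam x"
    and indep: "indep_vars (\<lambda>_. \<Pi>\<^sub>M t\<in>{0..}. count_space UNIV)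
        (\<lambda>x \<omega>. \<lambda>t\<in>{0..}. marks_count (\<sigma> x) t \<omega>) UNIV"
    and ab: "a \<noteq> b"
  shows "AE \<omega> in M. \<forall>i\<ge>1. \<forall>j\<ge>1. \<sigma> a i \<omega> \<noteq> \<sigma> b j \<omega>"
proof -
  let ?N = "\<lambda>x t \<omega>. marks_count (\<sigma> x) t \<omega>"
  have N_meas: "?N x t \<in> measurable M (count_space UNIV)" if "0 \<le> t" for x t
    using poisson that unfolding poisson_process_def by auto
  define E where "E = (\<lambda>h k. {\<omega> \<in> space M. ?N a ((real k + 1) * h) \<omega> - ?N a (real k * h) \<omega> \<noteq> 0}
      \<inter> {\<omega> \<in> space M. ?N b ((real k + 1) * h) \<omega> - ?N b (real k * h) \<omega> \<noteq> 0})"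
  have E_sets: "E h k \<in> events" if "0 < h" for h k
  proof -
    have [measurable]: "?N x (real k * h) \<in> measurable M (count_space UNIV)"
      "?N x ((real k + 1) * h) \<in> measurable M (count_space UNIV)" for x
      using that by (auto intro!: N_meas)
    show ?thesis unfolding E_def by measurable
  qed
  have E_prob: "prob (E h k) \<le> (lam a * h) * (lam b * h)" if h: "0 < h" for h k
  proof -
    let ?D = "\<lambda>x \<omega>. ?N x ((real k + 1) * h) \<omega> - ?N x (real k * h) \<omega>"
    have st: "0 \<le> real k * h" "real k * h < (real k + 1) * h" "0 \<le> (real k + 1) * h"
      using h by auto
    have len: "(real k + 1) * h - real k * h = h" by (simp add: algebra_simps)
    have "prob (\<Inter>x\<in>{a, b}. ?D x -` (- {0}) \<inter> space M) = (\<Prod>x\<in>{a, b}. prob (?D x -` (- {0}) \<inter> space M))"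
      using increments_indep[OF indep st(1,3)] by (rule indep_varsD) auto
    moreover have "(\<Inter>x\<in>{a, b}. ?D x -` (- {0}) \<inter> space M) = E h k"
      unfolding E_def by auto
    moreover have "?D x -` (- {0}) \<inter> space M = {\<omega> \<in> space M. ?D x \<omega> \<noteq> 0}" for x by auto
    ultimately have "prob (E h k) = prob {\<omega> \<in> space M. ?D a \<omega> \<noteq> 0} * prob {\<omega> \<in> space M. ?D b \<omega> \<noteq> 0}"
      using ab by simp
    also have "\<dots> \<le> (lam a * h) * (lam b * h)"
      using poisson_increment_prob_le[OF poisson lam st(1,2)] h less_imp_le[OF lam]
      by (intro mult_mono) (auto simp: len)
    finally show ?thesis .
  qed
  define C where "C = (\<lambda>n. {\<omega> \<in> space M. \<exists>i\<ge>1. \<exists>j\<ge>1. \<sigma> a i \<omega> = \<sigma> b j \<omega> \<and> \<sigma> a i \<omega> \<le> real n})"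
  have cover: "C n \<subseteq> (\<Union>k<n * m. E (1 / real m) k)" if m: "0 < m" for n m
  proof
    fix \<omega> assume "\<omega> \<in> C n"
    then obtain i j where w: "\<omega> \<in> space M" and ij: "1 \<le> i" "1 \<le> j" "\<sigma> a i \<omega> = \<sigma> b j \<omega>" "\<sigma> a i \<omega> \<le> real n"
      unfolding C_def by auto
    define s where "s = \<sigma> a i \<omega>"
    have pos: "0 < s"
      using marks_on_strict_mono[OF marks w, of 1 i a] ij(1) marks[of a] w
      unfolding s_def marks_on_def by (cases "i = 1") (auto intro: less_trans)
    \<comment> \<open>The cells are open on the left, so the index comes from the ceiling.\<close>
    define k where "k = nat (\<lceil>s * real m\<rceil> - 1)"
    have "0 < s * real m" using pos m by simp
    then have c1: "1 \<le> \<lceil>s * real m\<rceil>" by linarith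
    then have k: "real k = of_int \<lceil>s * real m\<rceil> - 1" unfolding k_def by simp
    have lo: "real k * (1 / real m) < s"
      using m k by (simp add: field_simps) linarith
    have hi: "s \<le> (real k + 1) * (1 / real m)"
      using m k by (simp add: field_simps)
    have "s * real m \<le> real (n * m)"
      using ij(4) m unfolding s_def by simp
    then have "\<lceil>s * real m\<rceil> \<le> int (n * m)" by (simp add: ceiling_le_iff)
    then have "k < n * m" using c1 unfolding k_def by linarith
    moreover have "\<omega> \<in> E (1 / real m) k"
      using marks_count_less[OF marks w ij(1), of "real k * (1 / real m)" a "(real k + 1) * (1 / real m)"]
        marks_count_less[OF marks w ij(2), of "real k * (1 / real m)" b "(real k + 1) * (1 / real m)"]
        lo hi w ij(3) unfolding E_def s_def by auto
    ultimately show "\<omega> \<in> (\<Union>k<n * m. E (1 / real m) k)" by blast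
  qed
  have bound: "prob (\<Union>k<n * m. E (1 / real m) k) \<le> real n * lam a * lam b / real m" if m: "0 < m" for n m
  proof -
    have "prob (\<Union>k<n * m. E (1 / real m) k) \<le> (\<Sum>k<n * m. prob (E (1 / real m) k))"
      using m E_sets by (intro measure_UNION_le) auto
    also have "\<dots> \<le> (\<Sum>k<n * m. (lam a * (1 / real m)) * (lam b * (1 / real m)))"
      using m by (intro sum_mono E_prob) simp
    also have "\<dots> = real n * lam a * lam b / real m"
      using m by (simp add: field_simps)
    finally show ?thesis .
  qed
  have null: "AE \<omega> in M. \<omega> \<notin> C n" for n
  proof -
    let ?Z = "\<Inter>m\<in>{0<..}. \<Union>k<n * m. E (1 / real m) k"
    have Z: "?Z \<in> events" using E_sets by (intro sets.countable_INT' sets.finite_UN) auto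
    have "prob ?Z \<le> real n * lam a * lam b / real m" if m: "0 < m" for m
      using bound[OF m, of n] E_sets m
      by (intro order_trans[OF finite_measure_mono bound[OF m, of n]]) auto
    then have "eventually (\<lambda>m. prob ?Z \<le> real n * lam a * lam b / real m) sequentially"
      by (intro eventually_sequentiallyI[of 1]) auto
    moreover have "(\<lambda>m. real n * lam a * lam b / real m) \<longlonglongrightarrow> 0"
      by (rule lim_const_over_n)
    ultimately have "prob ?Z \<le> 0"
      by (intro tendsto_lowerbound) auto
    then have "prob ?Z = 0" using measure_nonneg[of M ?Z] by linarith
    then have "?Z \<in> null_sets M" using Z by (simp add: emeasure_eq_measure null_setsI)
    then show ?thesis
      using cover by (intro AE_I'[of ?Z]) auto
  qed
  have "AE \<omega> in M. \<forall>n. \<omega> \<notin> C n" using null by (simp add: AE_all_countable)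
  then show ?thesis
  proof (rule AE_mp, intro AE_I2 impI)
    fix \<omega> assume w: "\<omega> \<in> space M" and nC: "\<forall>n. \<omega> \<notin> C n"
    show "\<forall>i\<ge>1. \<forall>j\<ge>1. \<sigma> a i \<omega> \<noteq> \<sigma> b j \<omega>"
      using nC w real_arch_simple unfolding C_def by blast
  qed
qed

lemma (in prob_space) no_marks_prob:
  fixes \<sigma> :: "'i \<Rightarrow> nat \<Rightarrow> 'a \<Rightarrow> real"
  assumes marks: "\<And>x. marks_on (space M) (\<sigma> x)"
    and poisson: "\<And>x. poisson_process M (lam x) (marks_count (\<sigma> x))"
    and lam: "\<And>x. 0 < lam x"
    and indep: "indep_vars (\<lambda>_. \<Pi>\<^sub>M t\<in>{0..}. count_space UNIV)
        (\<lambda>x \<omega>. \<lambda>t\<in>{0..}. marks_count (\<sigma> x) t \<omega>) UNIV"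
    and \<epsilon>: "0 < \<epsilon>" and F: "finite F"
  shows "prob {\<omega> \<in> space M. \<forall>z\<in>F. marks_count (\<sigma> z) \<epsilon> \<omega> = 0} = exp (- (\<epsilon> * sum lam F))"
proof (cases "F = {}")
  case True
  then show ?thesis by (simp add: prob_space)
next
  case False
  let ?D = "\<lambda>x \<omega>. marks_count (\<sigma> x) \<epsilon> \<omega> - marks_count (\<sigma> x) 0 \<omega>"
  have zero: "marks_count (\<sigma> z) 0 \<omega> = 0" if "\<omega> \<in> space M" for z \<omega>
    using marks_count_0[OF marks that] .
  have "{\<omega> \<in> space M. \<forall>z\<in>F. marks_count (\<sigma> z) \<epsilon> \<omega> = 0} = (\<Inter>z\<in>F. ?D z -` {0} \<inter> space M)"
    using False zero by auto
  also have "prob \<dots> = (\<Prod>z\<in>F. prob (?D z -` {0} \<inter> space M))"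
    using increments_indep[OF indep, of 0 \<epsilon>] \<epsilon> F False by (intro indep_varsD) auto
  also have "\<dots> = (\<Prod>z\<in>F. exp (- (lam z * \<epsilon>)))"
  proof (rule prod.cong)
    fix z assume "z \<in> F"
    have "?D z -` {0} \<inter> space M = {\<omega> \<in> space M. ?D z \<omega> = 0}" by auto
    then show "prob (?D z -` {0} \<inter> space M) = exp (- (lam z * \<epsilon>))"
      using poisson_no_increment_prob[OF poisson[of z] lam[of z], of 0 \<epsilon>] \<epsilon> by simp
  qed simp
  also have "\<dots> = exp (- (\<epsilon> * sum lam F))"
    using F by (simp add: exp_sum[symmetric] sum_negf sum_distrib_left mult.commute)
  finally show ?thesis .
qed

section \<open>The probability of being in a set at a small time\<close>

lemma (in prob_space) exponential_prob_le:
  assumes D: "distributed M lborel X (exponential_density 1)" and u: "0 \<le> u"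
  shows "prob {\<omega> \<in> space M. X \<omega> \<le> u} \<le> u"
  using exponential_distributedD_le[OF D u] exp_ge_add_one_self[of "- u"] by simp

lemma component_measurable_vimage_algebra:
  assumes "k \<in> I" and "\<And>k. k \<in> I \<Longrightarrow> X k \<in> \<Omega> \<rightarrow> space (N k)"
  shows "X k \<in> measurable (vimage_algebra \<Omega> (\<lambda>\<omega>. \<lambda>k\<in>I. X k \<omega>) (\<Pi>\<^sub>M k\<in>I. N k)) (N k)"
    (is "_ \<in> measurable (vimage_algebra \<Omega> ?f ?P) _")
proof -
  have "?f \<in> measurable (vimage_algebra \<Omega> ?f ?P) ?P"
    using assms by (intro measurable_vimage_algebra1) (auto simp: space_PiM Pi_iff)
  moreover have "(\<lambda>f. f k) \<in> measurable ?P (N k)"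
    using assms(1) by (rule measurable_component_singleton)
  ultimately have "(\<lambda>\<omega>. ?f \<omega> k) \<in> measurable (vimage_algebra \<Omega> ?f ?P) (N k)"
    by (rule measurable_compose)
  then show ?thesis using assms(1) by simp
qed

lemma marks_count_measurable_vimage_algebra:
  assumes "0 \<le> t"
  shows "marks_count (\<sigma> z) t \<in> measurable
     (vimage_algebra \<Omega> (\<lambda>\<omega>. \<lambda>x\<in>UNIV. \<lambda>t\<in>{0..}. marks_count (\<sigma> x) t \<omega>)
        (\<Pi>\<^sub>M x\<in>UNIV. \<Pi>\<^sub>M t\<in>{0..}. count_space UNIV)) (count_space UNIV)"
proof -
  have "(\<lambda>\<omega>. \<lambda>t\<in>{0..}. marks_count (\<sigma> z) t \<omega>) \<in> measurable
     (vimage_algebra \<Omega> (\<lambda>\<omega>. \<lambda>x\<in>UNIV. \<lambda>t\<in>{0..}. marks_count (\<sigma> x) t \<omega>)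
        (\<Pi>\<^sub>M x\<in>UNIV. \<Pi>\<^sub>M t\<in>{0..}. count_space UNIV)) (\<Pi>\<^sub>M t\<in>{0..}. count_space UNIV)"
    by (rule component_measurable_vimage_algebra) (auto simp: space_PiM PiE_def extensional_def)
  moreover have "(\<lambda>f. f t) \<in> measurable (\<Pi>\<^sub>M t\<in>{0..}. count_space UNIV) (count_space (UNIV :: nat set))"
    using assms by (intro measurable_component_singleton) auto
  ultimately have "(\<lambda>\<omega>. (\<lambda>t\<in>{0..}. marks_count (\<sigma> z) t \<omega>) t) \<in> measurable
     (vimage_algebra \<Omega> (\<lambda>\<omega>. \<lambda>x\<in>UNIV. \<lambda>t\<in>{0..}. marks_count (\<sigma> x) t \<omega>)
        (\<Pi>\<^sub>M x\<in>UNIV. \<Pi>\<^sub>M t\<in>{0..}. count_space UNIV)) (count_space UNIV)"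
    by (rule measurable_compose)
  then show ?thesis using assms by simp
qed

text \<open>
  Leaving \<open>x\<close> by time \<open>t\<close> costs \<open>t / \<gamma> x\<close>, and by independence this factor multiplies the
  probability of each of the three alternatives in \<open>K_process_in_imp\<close>: an early mark of \<open>A\<close>, no
  early mark of \<open>F\<close>, or a short first holding time of a state of \<open>F\<close>. The first two depend only
  on the marks and are independent of \<open>T0\<close> through \<open>families_indep\<close>, the third through
  \<open>exponential_indep\<close>.
\<close>

lemma (in prob_space) K_process_prob_le:
  fixes \<gamma> lam :: "'i::countable \<Rightarrow> real"
    and \<sigma> T :: "'i \<Rightarrow> nat \<Rightarrow> 'a \<Rightarrow> real"
  assumes \<gamma>: "\<And>x. 0 < \<gamma> x" and lam: "\<And>x. 0 < lam x" and c: "0 \<le> c"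
    and marks: "\<And>x. marks_on (space M) (\<sigma> x)"
    and poisson: "\<And>x. poisson_process M (lam x) (marks_count (\<sigma> x))"
    and poisson_indep: "indep_vars (\<lambda>_. \<Pi>\<^sub>M t\<in>{0..}. count_space UNIV)
          (\<lambda>x \<omega>. \<lambda>t\<in>{0..}. marks_count (\<sigma> x) t \<omega>) UNIV"
    and exponential: "\<And>k. k \<in> holding_index \<Longrightarrow>
          distributed M lborel (holding_family T0 T k) (exponential_density 1)"
    and exponential_indep: "indep_vars (\<lambda>_. borel) (holding_family T0 T) holding_index"
    and families_indep: "indep_set
          (sets (vimage_algebra (space M) (\<lambda>\<omega>. \<lambda>x\<in>UNIV. \<lambda>t\<in>{0..}. marks_count (\<sigma> x) t \<omega>)
             (\<Pi>\<^sub>M x\<in>UNIV. \<Pi>\<^sub>M t\<in>{0..}. count_space UNIV)))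
          (sets (vimage_algebra (space M) (\<lambda>\<omega>. \<lambda>k\<in>holding_index. holding_family T0 T k \<omega>)
             (\<Pi>\<^sub>M k\<in>holding_index. borel)))"
    and x: "x \<notin> A" and A: "lam summable_on A" and F: "finite F" and \<epsilon>: "0 < \<epsilon>" and t: "0 \<le> t"
  shows "prob {\<omega> \<in> space M. K_process \<gamma> c \<sigma> T0 T (Some x) t \<omega> \<in> Some ` A}
      \<le> t / \<gamma> x * (\<epsilon> * infsum lam A + exp (- (\<epsilon> * sum lam F)) + (\<Sum>z\<in>F. t / \<gamma> z))"
proof -
  let ?N = "\<lambda>z \<omega>. marks_count (\<sigma> z) \<epsilon> \<omega>"
  define MN where "MN = vimage_algebra (space M) (\<lambda>\<omega>. \<lambda>x\<in>UNIV. \<lambda>t\<in>{0..}. marks_count (\<sigma> x) t \<omega>)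
             (\<Pi>\<^sub>M x\<in>UNIV. \<Pi>\<^sub>M t\<in>{0::real..}. count_space (UNIV :: nat set))"
  define MH where "MH = vimage_algebra (space M) (\<lambda>\<omega>. \<lambda>k\<in>holding_index. holding_family T0 T k \<omega>)
             (\<Pi>\<^sub>M k\<in>holding_index. borel :: real measure)"
  have space_MN: "space MN = space M" and space_MH: "space MH = space M"
    unfolding MN_def MH_def by simp_all
  have idx: "None \<in> (holding_index :: ('i \<times> nat) option set)" "\<And>z. Some (z, 1) \<in> holding_index"
    unfolding holding_index_def by auto
  have T0_eq: "holding_family T0 T None = T0" and T_eq: "\<And>z. holding_family T0 T (Some (z, 1)) = T z 1"
    unfolding holding_family_def by auto
  have N_MN [measurable]: "?N z \<in> measurable MN (count_space UNIV)" for z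
    unfolding MN_def using \<epsilon> by (intro marks_count_measurable_vimage_algebra) auto
  have N_M [measurable]: "?N z \<in> measurable M (count_space UNIV)" for z
    using poisson \<epsilon> unfolding poisson_process_def by auto
  have T0_MH [measurable]: "T0 \<in> borel_measurable MH"
    using component_measurable_vimage_algebra[OF idx(1), of "holding_family T0 T" "space M" "\<lambda>_. borel"]
    unfolding MH_def T0_eq by simp
  have T0_M [measurable]: "T0 \<in> borel_measurable M"
    using distributed_measurable[OF exponential[OF idx(1)]] unfolding T0_eq by simp
  have T_M [measurable]: "T z 1 \<in> borel_measurable M" for z
    using distributed_measurable[OF exponential[OF idx(2)]] unfolding T_eq by simp

  define u where "u = t / \<gamma> x"
  have u: "0 \<le> u" using t \<gamma>[of x] unfolding u_def by simp
  define H where "H = {\<omega> \<in> space M. T0 \<omega> \<le> u}"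
  define E1 where "E1 = {\<omega> \<in> space M. \<exists>a\<in>A. ?N a \<omega> \<noteq> 0}"
  define E2 where "E2 = {\<omega> \<in> space M. \<forall>z\<in>F. ?N z \<omega> = 0}"
  define G where "G = (\<lambda>z. {\<omega> \<in> space M. T z 1 \<omega> \<le> t / \<gamma> z})"
  have A_countable: "countable A" by simp
  have [measurable]: "H \<in> events" "E1 \<in> events" "E2 \<in> events" "G z \<in> events" for z
    using F A_countable unfolding H_def E1_def E2_def G_def by measurable
  have H_MH: "H \<in> sets MH"
    unfolding H_def space_MH[symmetric] by measurable
  have E_MN: "E1 \<in> sets MN" "E2 \<in> sets MN"
    using F A_countable unfolding E1_def E2_def space_MN[symmetric] by measurable
  have H_prob: "prob H \<le> u"
    using exponential_prob_le[OF exponential[OF idx(1)] u] unfolding T0_eq H_def .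

  have EH: "prob (E \<inter> H) \<le> p * u" if E: "E \<in> sets MN" and p: "prob E \<le> p" for E p
  proof -
    have "prob (E \<inter> H) = prob E * prob H"
      using families_indep E H_MH unfolding MN_def MH_def by (rule indep_setD)
    also have "\<dots> \<le> p * u"
      using p H_prob by (intro mult_mono) (auto intro: order_trans[OF measure_nonneg p])
    finally show ?thesis .
  qed

  have E1_prob: "prob E1 \<le> \<epsilon> * infsum lam A"
  proof -
    have "E1 = (\<Union>a\<in>A. {\<omega> \<in> space M. ?N a \<omega> \<noteq> 0})" unfolding E1_def by auto
    also have "prob \<dots> \<le> (\<Sum>\<^sub>\<infinity>a\<in>A. \<epsilon> * lam a)"
    proof (rule prob_UN_le_infsum)
      show "prob {\<omega> \<in> space M. ?N a \<omega> \<noteq> 0} \<le> \<epsilon> * lam a" for a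
      proof -
        have "{\<omega> \<in> space M. ?N a \<omega> \<noteq> 0} = {\<omega> \<in> space M. ?N a \<omega> - marks_count (\<sigma> a) 0 \<omega> \<noteq> 0}"
          using marks_count_0[OF marks] by auto
        then show ?thesis
          using poisson_increment_prob_le[OF poisson lam, of 0 \<epsilon> a] \<epsilon> by (simp add: mult.commute)
      qed
    qed (use A in \<open>auto intro: summable_on_cmult_right\<close>)
    also have "\<dots> = \<epsilon> * infsum lam A" using A by (intro infsum_cmult_right) auto
    finally show ?thesis .
  qed
  have E2_prob: "prob E2 \<le> exp (- (\<epsilon> * sum lam F))"
    unfolding E2_def using no_marks_prob[OF marks poisson lam poisson_indep \<epsilon> F] by simp

  have GH: "prob (H \<inter> G z) \<le> u * (t / \<gamma> z)" for z
  proof -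
    let ?X = "holding_family T0 T"
    let ?B = "\<lambda>k. if k = None then {..u} else {..t / \<gamma> z}"
    have "prob (\<Inter>k\<in>{None, Some (z, 1)}. ?X k -` ?B k \<inter> space M)
        = (\<Prod>k\<in>{None, Some (z, 1)}. prob (?X k -` ?B k \<inter> space M))"
      using exponential_indep by (rule indep_varsD) (use idx in auto)
    moreover have "?X None -` ?B None \<inter> space M = H" "?X (Some (z, 1)) -` ?B (Some (z, 1)) \<inter> space M = G z"
      unfolding H_def G_def T0_eq T_eq by auto
    ultimately have "prob (H \<inter> G z) = prob H * prob (G z)" by simp
    also have "\<dots> \<le> u * (t / \<gamma> z)"
    proof (intro mult_mono H_prob u measure_nonneg)
      show "prob (G z) \<le> t / \<gamma> z"
        using exponential_prob_le[OF exponential[OF idx(2)], of "t / \<gamma> z"] t less_imp_le[OF \<gamma>]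
        unfolding T_eq G_def by simp
    qed
    finally show ?thesis .
  qed

  let ?S = "{\<omega> \<in> space M. K_process \<gamma> c \<sigma> T0 T (Some x) t \<omega> \<in> Some ` A}"
  let ?R = "(E1 \<inter> H) \<union> (E2 \<inter> H) \<union> (\<Union>z\<in>F. H \<inter> G z)"
  have "AE \<omega> in M. a \<noteq> b \<longrightarrow> (\<forall>i\<ge>1. \<forall>j\<ge>1. \<sigma> a i \<omega> \<noteq> \<sigma> b j \<omega>)" for a b
    using no_common_marks[OF marks poisson lam poisson_indep, of a b] by (cases "a = b") auto
  then have "AE \<omega> in M. \<forall>a b. a \<noteq> b \<longrightarrow> (\<forall>i\<ge>1. \<forall>j\<ge>1. \<sigma> a i \<omega> \<noteq> \<sigma> b j \<omega>)"
    by (simp add: AE_all_countable)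
  then have AE: "AE \<omega> in M. \<omega> \<in> ?S \<longrightarrow> \<omega> \<in> ?R"
  proof (rule AE_mp, intro AE_I2 impI)
    fix \<omega> assume w: "\<omega> \<in> space M" "\<omega> \<in> ?S"
      and disj: "\<forall>a b. a \<noteq> b \<longrightarrow> (\<forall>i\<ge>1. \<forall>j\<ge>1. \<sigma> a i \<omega> \<noteq> \<sigma> b j \<omega>)"
    from w(2) have K: "K_process \<gamma> c \<sigma> T0 T (Some x) t \<omega> \<in> Some ` A" by simp
    note KI = K_process_in_imp[where \<Omega> = "space M" and \<sigma> = \<sigma>, OF marks w(1) c t _ x K]
    have "\<gamma> x * T0 \<omega> \<le> t" using disj by (intro KI) auto
    then have "\<omega> \<in> H" using w(1) \<gamma>[of x] by (simp add: H_def u_def field_simps)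
    moreover have "(\<exists>a\<in>A. ?N a \<omega> \<noteq> 0) \<or> (\<forall>z\<in>F. ?N z \<omega> = 0) \<or> (\<exists>z\<in>F. \<gamma> z * T z 1 \<omega> \<le> t)"
      using disj by (intro KI) auto
    then have "\<omega> \<in> E1 \<or> \<omega> \<in> E2 \<or> (\<exists>z\<in>F. \<omega> \<in> G z)"
      using w(1) \<gamma> unfolding E1_def E2_def G_def by (auto simp: pos_le_divide_eq mult.commute)
    ultimately show "\<omega> \<in> ?R" by blast
  qed
  have UG: "(\<Union>z\<in>F. H \<inter> G z) \<in> events" using F by (intro sets.finite_UN) auto
  \<comment> \<open>Only \<open>?R\<close> has to be measurable here: a set outside \<open>events\<close> has measure 0.\<close>
  have "prob ?S \<le> prob ?R"
    using AE UG by (intro finite_measure_mono_AE) auto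
  also have "\<dots> \<le> prob (E1 \<inter> H) + prob (E2 \<inter> H) + prob (\<Union>z\<in>F. H \<inter> G z)"
    using UG by (intro order_trans[OF measure_Un_le] add_mono measure_Un_le) auto
  also have "\<dots> \<le> \<epsilon> * infsum lam A * u + exp (- (\<epsilon> * sum lam F)) * u + (\<Sum>z\<in>F. u * (t / \<gamma> z))"
    using F GH E_MN E1_prob E2_prob
    by (intro add_mono EH order_trans[OF measure_UNION_le] sum_mono) auto
  also have "\<dots> = u * (\<epsilon> * infsum lam A + exp (- (\<epsilon> * sum lam F)) + (\<Sum>z\<in>F. t / \<gamma> z))"
    by (simp add: sum_distrib_left algebra_simps)
  finally show ?thesis unfolding u_def .
qed

section \<open>The limit\<close>

lemma finite_sum_unbounded_if_not_summable:
  fixes f :: "'i \<Rightarrow> real"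
  assumes "\<And>x. 0 \<le> f x" and "\<not> f summable_on UNIV"
  obtains F where "finite F" "b < sum f F"
proof -
  have "\<not> bdd_above (sum f ` {F. F \<subseteq> UNIV \<and> finite F})"
    using assms nonneg_bdd_above_summable_on[of UNIV f] by blast
  then show ?thesis using that by (auto simp: bdd_above_def not_le)
qed

text \<open>
  The constants are chosen in the order \<open>\<epsilon>\<close>, \<open>F\<close>, \<open>t\<close>: a small \<open>\<epsilon>\<close> controls the first term, then a
  finite \<open>F\<close> with large total rate the exponential (here the divergence of the rates enters), and
  finally a small \<open>t\<close> the finite sum.
\<close>

lemma tendsto_0_of_clock_bound:
  fixes \<gamma> lam :: "'i \<Rightarrow> real" and p :: "real \<Rightarrow> real"
  assumes lam: "\<And>x. 0 \<le> lam x" and div: "\<not> lam summable_on UNIV" and g: "0 < g"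
    and L: "0 \<le> L" and p0: "\<And>t. 0 \<le> p t"
    and p: "\<And>\<epsilon> F t. 0 < \<epsilon> \<Longrightarrow> finite F \<Longrightarrow> 0 \<le> t \<Longrightarrow>
       p t \<le> t / g * (\<epsilon> * L + exp (- (\<epsilon> * sum lam F)) + (\<Sum>z\<in>F. t / \<gamma> z))"
  shows "((\<lambda>t. p t / t) \<longlongrightarrow> 0) (at_right 0)"
proof (rule order_tendstoI)
  fix a :: real assume "a < 0"
  then show "eventually (\<lambda>t. a < p t / t) (at_right 0)"
    using p0 by (auto simp: eventually_at_filter intro!: always_eventually less_le_trans[of a 0])
next
  fix e :: real assume e: "0 < e"
  define d where "d = e * g / 3"
  have d: "0 < d" using e g unfolding d_def by simp
  define \<epsilon> where "\<epsilon> = d / (L + 1)"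
  have \<epsilon>: "0 < \<epsilon>" "\<epsilon> * L < d" using d L unfolding \<epsilon>_def by (auto simp: field_simps)
  obtain F where F: "finite F" "- ln d / \<epsilon> < sum lam F"
    using finite_sum_unbounded_if_not_summable[OF lam div] by blast
  have "- (\<epsilon> * sum lam F) < ln d" using F(2) \<epsilon>(1) by (simp add: field_simps)
  then have exp: "exp (- (\<epsilon> * sum lam F)) < d"
    using d exp_less_mono[of "- (\<epsilon> * sum lam F)" "ln d"] by simp
  have "((\<lambda>t. \<Sum>z\<in>F. t / \<gamma> z) \<longlongrightarrow> (\<Sum>z\<in>F. 0 / \<gamma> z)) (at_right 0)"
    unfolding divide_inverse by (intro tendsto_intros)
  then have "eventually (\<lambda>t. (\<Sum>z\<in>F. t / \<gamma> z) < d) (at_right 0)"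
    using d by (intro order_tendstoD(2)[of _ 0]) auto
  moreover have "eventually (\<lambda>t::real. 0 < t) (at_right 0)"
    by (simp add: eventually_at_filter)
  ultimately show "eventually (\<lambda>t. p t / t < e) (at_right 0)"
  proof eventually_elim
    case (elim t)
    have "p t \<le> t / g * (\<epsilon> * L + exp (- (\<epsilon> * sum lam F)) + (\<Sum>z\<in>F. t / \<gamma> z))"
      using elim \<epsilon> F by (intro p) auto
    also have "\<dots> < t / g * (3 * d)"
      using elim \<epsilon> exp g by (intro mult_strict_left_mono) auto
    also have "\<dots> = t * e" using g unfolding d_def by simp
    finally show ?case using elim by (simp add: field_simps)
  qed
qed

theorem proposition5p5:
  fixes M :: "'w measure"
    and \<gamma> lam :: "'a::countable \<Rightarrow> real"
    and c :: real
    and \<sigma> T :: "'a \<Rightarrow> nat \<Rightarrow> 'w \<Rightarrow> real"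
    and T0 :: "'w \<Rightarrow> real"
  assumes infinite_states: "infinite (UNIV :: 'a set)"
    and gamma_pos: "\<And>x. 0 < \<gamma> x"
    and lam_pos: "\<And>x. 0 < lam x"
    and c_nonneg: "0 \<le> c"
    and lam_diverges: "\<not> lam summable_on UNIV"
    and lam_gamma_summable: "(\<lambda>x. lam x * \<gamma> x) summable_on UNIV"
    and prob: "prob_space M"
    and marks: "\<And>x. marks_on (space M) (\<sigma> x)"
    and poisson: "\<And>x. poisson_process M (lam x) (marks_count (\<sigma> x))"
    and poisson_indep: "prob_space.indep_vars M (\<lambda>_. \<Pi>\<^sub>M t\<in>{0..}. count_space UNIV)
          (\<lambda>x \<omega>. \<lambda>t\<in>{0..}. marks_count (\<sigma> x) t \<omega>) UNIV"
    and exponential: "\<And>k. k \<in> holding_index \<Longrightarrow>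
          distributed M lborel (holding_family T0 T k) (exponential_density 1)"
    and exponential_indep: "prob_space.indep_vars M (\<lambda>_. borel) (holding_family T0 T) holding_index"
    and families_indep: "prob_space.indep_set M
          (sets (vimage_algebra (space M) (\<lambda>\<omega>. \<lambda>x\<in>UNIV. \<lambda>t\<in>{0..}. marks_count (\<sigma> x) t \<omega>)
             (\<Pi>\<^sub>M x\<in>UNIV. \<Pi>\<^sub>M t\<in>{0..}. count_space UNIV)))
          (sets (vimage_algebra (space M) (\<lambda>\<omega>. \<lambda>k\<in>holding_index. holding_family T0 T k \<omega>)
             (\<Pi>\<^sub>M k\<in>holding_index. borel)))"
  shows "(\<forall>x A. A \<subseteq> UNIV - {x} \<longrightarrow> lam summable_on A \<longrightarrow>
            ((\<lambda>t. measure M {\<omega> \<in> space M. K_process \<gamma> c \<sigma> T0 T (Some x) t \<omega> \<in> Some ` A} / t) \<longlongrightarrow> 0)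
              (at_right 0))
       \<and> (\<forall>x y. y \<noteq> x \<longrightarrow> has_transition_rate M (K_process \<gamma> c \<sigma> T0 T) (Some x) (Some y) 0)"
proof -
  interpret prob_space M by (rule prob)
  have lim: "((\<lambda>t. prob {\<omega> \<in> space M. K_process \<gamma> c \<sigma> T0 T (Some x) t \<omega> \<in> Some ` A} / t) \<longlongrightarrow> 0)
      (at_right 0)" if A: "A \<subseteq> UNIV - {x}" "lam summable_on A" for x A
  proof (rule tendsto_0_of_clock_bound[OF less_imp_le[OF lam_pos] lam_diverges gamma_pos])
    show "0 \<le> infsum lam A" using lam_pos by (intro infsum_nonneg less_imp_le)
    show "prob {\<omega> \<in> space M. K_process \<gamma> c \<sigma> T0 T (Some x) t \<omega> \<in> Some ` A}
        \<le> t / \<gamma> x * (\<epsilon> * infsum lam A + exp (- (\<epsilon> * sum lam F)) + (\<Sum>z\<in>F. t / \<gamma> z))"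
      if "0 < \<epsilon>" "finite F" "0 \<le> t" for \<epsilon> F t
      using K_process_prob_le[where \<gamma> = \<gamma>, OF gamma_pos lam_pos c_nonneg marks poisson poisson_indep exponential
          exponential_indep families_indep _ A(2) that(2,1,3), of x] A(1) by auto
  qed simp
  moreover have "has_transition_rate M (K_process \<gamma> c \<sigma> T0 T) (Some x) (Some y) 0" if "y \<noteq> x" for x y
    using lim[of "{y}" x] that by (simp add: has_transition_rate_def transition_prob_def)
  ultimately show ?thesis by blast
qed

end
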